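(* Let $n\ge 3$. For every $\hat Z\in\mathbb{L}(n)$ there are $n+2=\dim\mathbb{L}(n)$ linearly independent straight lines contained in the intersection $\mathbb{L}(n)\cap T_{\hat Z}\mathbb{L}(n)$. Furthermore, there are subsets of $\mathbb{L}(n)\cap T_{\hat Z}\mathbb{L}(n)$ isometric to $\mathbb{R}^{n+1}\smallsetminus\mathbb{R}^2$ and to $\mathbb{R}^2\smallsetminus\{\vec 0\}$, respectively.
   Context: Let $n\ge 3$ and $\mathcal{D}_n=\{(b,\dots,b)\in\mathbb{C}^n : b\in\mathbb{C}\}$. $\mathbb{L}(n)\subset\mathbb{C}^n$ is the set of $n$-segments: points $(z_1,\dots,z_n)\in\mathbb{C}^n\smallsetminus\mathcal{D}_n$ such that $z_1,\dots,z_n$ lie on a common real straight line in $\mathbb{C}$. It is a smooth real $(n+2)$-dimensional submanifold of $\mathbb{C}^n\cong\mathbb{R}^{2n}$. Here $T_{\hat Z}\mathbb{L}(n)$ denotes the affine tangent space, i.e. the translate $\hat Z+\{\alpha'(0)\}$ where $\alpha$ ranges over differentiable curves in $\mathbb{L}(n)$ with $\alpha(0)=\hat Z$. $\mathbb{C}^n\cong\mathbb{R}^{2n}$ carries the Euclidean inner product $\langle\!\langle Z,W\rangle\!\rangle=\sum_j \mathrm{Re}(z_j\overline{w_j})$; straight lines are full real affine lines $\{P+tv : t\in\mathbb{R}\}$, $v\neq 0$, in $\mathbb{C}^n$; lines are linearly independent when their direction vectors are linearly independent over $\mathbb{R}$; isometry is with respect to the Euclidean distances. $\mathbb{R}^{n+1}\smallsetminus\mathbb{R}^2$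 denotes the complement of a $2$-dimensional linear subspace in $\mathbb{R}^{n+1}$. *)

theory Defs
  imports "HOL-Analysis.Analysis"
begin

text \<open>
  \<open>\<complex>\<^sup>n\<close> is \<^typ>\<open>complex ^ 'n\<close> with \<open>n = CARD('n)\<close>, used as a real Euclidean space: its
  library inner product is the sum of the \<open>Re (z\<^sub>j * cnj w\<^sub>j)\<close>, and \<open>independent\<close>, \<open>dim\<close>, \<open>subspace\<close>
  and \<open>collinear\<close> refer to real scalars.
\<close>

definition diagonal :: "(complex ^ 'n) set" where
  "diagonal = {z. \<exists>b. \<forall>j. z $ j = b}"

definition n_segments :: "(complex ^ 'n) set" where
  "n_segments = {z. z \<notin> diagonal \<and> collinear (range (\<lambda>j. z $ j))}"

text \<open>
  Dimension of a manifold embedded in a Euclidean space: every point has a relatively open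
  neighbourhood homeomorphic to an open subset of \<open>\<real>\<^sup>k\<close>. To let \<open>k\<close> be a number, the model space
  \<open>\<real>\<^sup>k\<close> is taken to be a \<open>k\<close>-dimensional linear subspace of the ambient space.
\<close>

definition manifold_of_dim :: "nat \<Rightarrow> 'a::euclidean_space set \<Rightarrow> bool" where
  "manifold_of_dim k M \<longleftrightarrow>
     (\<forall>x\<in>M. \<exists>U V W. x \<in> U \<and> openin (top_of_set M) U \<and>
        subspace (V :: 'a set) \<and> dim V = k \<and> openin (top_of_set V) W \<and> U homeomorphic W)"

definition tangent_vectors :: "'a::real_normed_vector set \<Rightarrow> 'a \<Rightarrow> 'a set" where
  "tangent_vectors M x =
     {v. \<exists>(\<alpha> :: real \<Rightarrow> 'a) e. e > 0 \<and> \<alpha> ` {-e<..<e} \<subseteq> M \<and>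
           \<alpha> differentiable_on {-e<..<e} \<and> \<alpha> 0 = x \<and> (\<alpha> has_vector_derivative v) (at 0)}"

definition affine_tangent_space :: "'a::real_normed_vector set \<Rightarrow> 'a \<Rightarrow> 'a set" where
  "affine_tangent_space M x = (\<lambda>v. x + v) ` tangent_vectors M x"

definition line_through :: "'a::real_vector \<Rightarrow> 'a \<Rightarrow> 'a set" where
  "line_through p v = range (\<lambda>t::real. p + t *\<^sub>R v)"

text \<open>
  Injectivity makes the directions \<open>v L\<close> linearly independent as an indexed family, so that
  distinct parallel lines are not independent; independence also forces \<open>v L \<noteq> 0\<close>.
\<close>

definition independent_lines :: "'a::real_vector set set \<Rightarrow> bool" where
  "independent_lines \<L> \<longleftrightarrow>
     (\<exists>p v. (\<forall>L\<in>\<L>. L = line_through (p L) (v L)) \<and> inj_on v \<L> \<and> independent (v ` \<L>))"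

definition isometric :: "'a::metric_space set \<Rightarrow> 'b::metric_space set \<Rightarrow> bool" where
  "isometric S T \<longleftrightarrow> (\<exists>f. f ` S = T \<and> (\<forall>x\<in>S. \<forall>y\<in>S. dist (f x) (f y) = dist x y))"

end

theory Submission
  imports Defs
begin

text \<open>
  An \<open>n\<close>-segment is \<open>z\<^sub>j = b + w x\<^sub>j\<close> with \<open>b, w \<in> \<complex>\<close>, \<open>\<bar>w\<bar> = 1\<close> and \<open>x \<in> \<real>\<^sup>n\<close> not constant. Its tangent
  space contains the linear space \<open>w (\<real>\<^sup>n + \<i> span {1, x})\<close>, which in turn contains \<open>z\<close>, so that
  the affine and the linear tangent space coincide. The hyperplane \<open>H = w (\<real>\<^sup>n + \<i> \<real> 1)\<close> of that
  space meets the complement of the \<open>n\<close>-segments exactly in the diagonal, which is a plane; this is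
  the copy of \<open>\<real>\<^bsup>n+1\<^esup>\<close> without a plane. As \<open>dim H > 3\<close>, every direction in \<open>H\<close> is the direction of
  a line in \<open>H\<close> that avoids the diagonal. The missing direction is \<open>\<i> w x\<close>, which together with
  \<open>w x\<close> spans a plane whose nonzero points are \<open>n\<close>-segments.

  For the manifold property, an \<open>n\<close>-segment with \<open>z\<^sub>a \<noteq> z\<^sub>b\<close> is determined by \<open>z\<^sub>a\<close>, \<open>z\<^sub>b\<close> and the
  real ratios \<open>(z\<^sub>k - z\<^sub>a) / (z\<^sub>b - z\<^sub>a)\<close>.
\<close>

section \<open>Parametrised segments and their tangent spaces\<close>

lemma n_segmentsI:
  fixes z :: "complex ^ 'n"
  assumes z: "\<And>j. z $ j = b + w * of_real (x j)" and "w \<noteq> 0" and "x k \<noteq> x l"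
  shows "z \<in> n_segments"
proof -
  have "z \<notin> diagonal"
  proof
    assume "z \<in> diagonal"
    then have "z $ k = z $ l" by (auto simp: diagonal_def)
    then show False using assms by simp
  qed
  moreover have "collinear (range (\<lambda>j. z $ j))"
    unfolding collinear_def
  proof (intro exI[of _ w] ballI)
    fix p q assume "p \<in> range (\<lambda>j. z $ j)" "q \<in> range (\<lambda>j. z $ j)"
    then obtain i j where "p = z $ i" "q = z $ j" by auto
    then have "p - q = (x i - x j) *\<^sub>R w"
      by (simp add: z scaleR_conv_of_real[where 'a=complex] algebra_simps)
    then show "\<exists>c. p - q = c *\<^sub>R w" ..
  qed
  ultimately show ?thesis by (simp add: n_segments_def)
qed

lemma n_segments_neq:
  assumes "z \<in> n_segments"
  obtains k l where "z $ k \<noteq> z $ l"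
  using assms unfolding n_segments_def diagonal_def by blast

text \<open>The length of the direction is absorbed into \<open>x\<close>, so that multiplication by
  \<open>w\<close> preserves norms; the isometries built later rely on this.\<close>

lemma n_segmentsE:
  fixes z :: "complex ^ 'n"
  assumes "z \<in> n_segments"
  obtains b w x k l where "norm w = 1" "\<And>j. z $ j = b + w * of_real (x j)" "x k \<noteq> (x l :: real)"
proof -
  obtain k l where kl: "z $ k \<noteq> z $ l" using assms by (rule n_segments_neq)
  obtain u where u: "\<And>i j. \<exists>c. z $ i - z $ j = c *\<^sub>R u"
    using assms unfolding n_segments_def collinear_def by blast
  then have "\<forall>i. \<exists>c. z $ i - z $ l = c *\<^sub>R u" by blast
  then obtain c where c: "\<And>i. z $ i - z $ l = c i *\<^sub>R u" by metis
  have "u \<noteq> 0" using c[of k] kl by auto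
  have z: "z $ j = z $ l + sgn u * of_real (c j * norm u)" for j
    using c[of j] \<open>u \<noteq> 0\<close> by (simp add: sgn_eq scaleR_conv_of_real[where 'a=complex] algebra_simps)
  then show ?thesis
    using that[of "sgn u" "z $ l" "\<lambda>j. c j * norm u" k l] \<open>u \<noteq> 0\<close> kl
    by (metis norm_sgn)
qed

text \<open>Here \<open>u\<close> is a point of the tangent space, not a velocity. As
  \<open>z\<close> has the form required of \<open>u\<close>, so has \<open>u - z\<close>, which is
  the velocity at 0 of an explicit quadratic curve of segments.\<close>

lemma mem_affine_tangent_space_n_segments:
  fixes z u :: "complex ^ 'n"
  assumes z: "\<And>j. z $ j = b + w * of_real (x j)" and "w \<noteq> 0" and kl: "x k \<noteq> x l"
    and u: "\<And>j. u $ j = w * (of_real (y j) + \<i> * of_real (s + r * x j))"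
  shows "u \<in> affine_tangent_space n_segments z"
proof -
  define p where "p = Re (b / w)"
  define q where "q = Im (b / w)"
  have b: "b = w * (of_real p + \<i> * of_real q)"
    using \<open>w \<noteq> 0\<close> unfolding p_def q_def by (simp add: complex_eq[symmetric])
  define \<xi> where "\<xi> j = y j - p - x j" for j
  \<comment> \<open>The second-order term of
    \<open>w * (1 + \<i> * r * t) * (x j + t * \<xi> j)\<close>; adding it to the straight path from
    \<open>z\<close> keeps the coordinates collinear.\<close>
  define Q :: "complex ^ 'n" where "Q = (\<chi> j. w * \<i> * of_real (r * \<xi> j))"
  define \<alpha> where "\<alpha> t = z + t *\<^sub>R (u - z) + t\<^sup>2 *\<^sub>R Q" for t :: real
  \<comment> \<open>The line is rotated by \<open>1 + \<i> r t\<close> while \<open>x\<close> moves with velocity \<open>\<xi>\<close>.\<close>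
  have \<alpha>: "\<alpha> t $ j = (b + w * \<i> * of_real (t * (s - q))) +
      w * (1 + \<i> * of_real (r * t)) * of_real (x j + t * \<xi> j)" for t j
    unfolding \<alpha>_def Q_def \<xi>_def using b
    by (simp add: z u scaleR_conv_of_real[where 'a=complex] algebra_simps power2_eq_square)
  \<comment> \<open>For \<open>\<bar>t\<bar> < e\<close> the drift
    \<open>t * (\<xi> k - \<xi> l)\<close> cannot cancel \<open>x k - x l\<close>. The summand 1
    keeps the denominator positive.\<close>
  define e where "e = \<bar>x k - x l\<bar> / (1 + \<bar>\<xi> k - \<xi> l\<bar>)"
  have "e > 0" using kl by (simp add: e_def)
  have "\<alpha> t \<in> n_segments" if "t \<in> {-e<..<e}" for t
  proof (rule n_segmentsI[OF \<alpha>])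
    have "1 + \<i> * complex_of_real (r * t) \<noteq> 0"
      by (simp add: complex_eq_iff)
    then show "w * (1 + \<i> * of_real (r * t)) \<noteq> 0" using \<open>w \<noteq> 0\<close> by simp
    have "\<bar>t\<bar> < e" using that by auto
    then have "\<bar>t\<bar> * (1 + \<bar>\<xi> k - \<xi> l\<bar>) < \<bar>x k - x l\<bar>"
      by (simp add: e_def pos_less_divide_eq)
    moreover have "\<bar>t * (\<xi> k - \<xi> l)\<bar> \<le> \<bar>t\<bar> * (1 + \<bar>\<xi> k - \<xi> l\<bar>)"
      by (simp add: abs_mult mult_left_mono)
    ultimately have "\<bar>t * (\<xi> k - \<xi> l)\<bar> < \<bar>x k - x l\<bar>" by linarith
    then show "x k + t * \<xi> k \<noteq> x l + t * \<xi> l"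
      by (auto simp: algebra_simps abs_if split: if_splits)
  qed
  moreover have \<alpha>': "(\<alpha> has_vector_derivative (u - z) + (2 * t) *\<^sub>R Q) (at t)" for t
    unfolding \<alpha>_def has_vector_derivative_def
    by (auto intro!: derivative_eq_intros simp: algebra_simps fun_eq_iff)
  moreover have "\<alpha> differentiable_on {-e<..<e}"
    unfolding differentiable_on_def
    using \<alpha>' by (meson differentiable_at_withinI differentiableI_vector)
  moreover have "\<alpha> 0 = z" by (simp add: \<alpha>_def)
  ultimately have "u - z \<in> tangent_vectors n_segments z"
    unfolding tangent_vectors_def using \<open>e > 0\<close> \<alpha>'[of 0]
    by (intro CollectI exI[of _ \<alpha>] exI[of _ e]) auto
  then show ?thesis
    unfolding affine_tangent_space_def by (intro image_eqI[of _ _ "u - z"]) auto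
qed

section \<open>Norm-preserving maps, independent lines and dimension counts\<close>

lemma norm_preserving_linear_isometric:
  fixes f :: "'a::real_normed_vector \<Rightarrow> 'b::real_normed_vector"
  assumes "linear f" and "\<And>u. norm (f u) = norm u"
  shows "inj f" and "isometric (f ` S) S"
proof -
  have d: "dist (f u) (f v) = dist u v" for u v
    using assms by (simp add: dist_norm flip: linear_diff)
  then show "inj f" by (metis injI dist_eq_0_iff)
  then have inv: "inv f (f u) = u" for u by simp
  have "inv f ` f ` S = S" by (simp add: image_image inv)
  then show "isometric (f ` S) S"
    unfolding isometric_def by (intro exI[of _ "inv f"]) (auto simp: inv d)
qed

lemma line_through_direction:
  assumes "line_through p v = line_through q u"
  shows "v \<in> span {u}"
proof -
  have "p \<in> line_through p v" "p + v \<in> line_through p v"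
    unfolding line_through_def by (auto intro: image_eqI[of _ _ 0] image_eqI[of _ _ 1])
  then obtain s t where p: "p = q + s *\<^sub>R u" and v: "p + v = q + t *\<^sub>R u"
    unfolding assms unfolding line_through_def by blast
  have "v = (t - s) *\<^sub>R u" using v unfolding p by (simp add: algebra_simps)
  then show ?thesis by (simp add: span_mul span_base)
qed

text \<open>Equal lines have proportional directions, so independent directions give distinct lines
  for any choice of base points.\<close>

lemma independent_lines_of_directions:
  assumes B: "independent B"
    and lines: "\<And>v. v \<in> B \<Longrightarrow> \<exists>p. line_through p v \<subseteq> X"
  obtains \<L> where "card \<L> = card B" "independent_lines \<L>" "\<And>L. L \<in> \<L> \<Longrightarrow> L \<subseteq> X"
proof -
  obtain p where p: "\<And>v. v \<in> B \<Longrightarrow> line_through (p v) v \<subseteq> X"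
    using lines by metis
  define \<l> where "\<l> v = line_through (p v) v" for v
  have inj: "inj_on \<l> B"
  proof (rule inj_onI, rule ccontr)
    fix u v assume "u \<in> B" "v \<in> B" "\<l> u = \<l> v" "u \<noteq> v"
    then have "u \<in> span (B - {u})"
      unfolding \<l>_def using line_through_direction span_mono[of "{v}" "B - {u}"] by blast
    then show False using B \<open>u \<in> B\<close> by (auto simp: dependent_def)
  qed
  have "independent_lines (\<l> ` B)"
    unfolding independent_lines_def
  proof (intro exI conjI ballI)
    let ?v = "inv_into B \<l>"
    show "L = line_through (p (?v L)) (?v L)" if "L \<in> \<l> ` B" for L
      using f_inv_into_f[OF that] by (simp add: \<l>_def)
    show "inj_on ?v (\<l> ` B)" by (simp add: inj_on_inv_into)
    show "independent (?v ` \<l> ` B)" using B inj by simp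
  qed
  then show ?thesis
    using that[of "\<l> ` B"] card_image[OF inj] p by (auto simp: \<l>_def)
qed

text \<open>A line through \<open>p\<close> with direction \<open>v\<close> can meet
  \<open>D\<close> only if \<open>p\<close> lies in the span of \<open>v\<close> and
  \<open>D\<close>, which is too small to contain \<open>H\<close>.\<close>

lemma exists_line_avoiding_subspace:
  fixes H D :: "'a::euclidean_space set"
  assumes "dim D + 1 < dim H"
  obtains p where "p \<in> H" "line_through p v \<inter> D = {}"
proof -
  have "dim (insert v D) < dim H"
    using assms by (simp add: dim_insert)
  then have "\<not> H \<subseteq> span (insert v D)"
    using dim_subset[of H "span (insert v D)"] by (metis dim_span not_le)
  then obtain p where p: "p \<in> H" "p \<notin> span (insert v D)" by blast
  have "p + t *\<^sub>R v \<notin> D" for t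
  proof
    assume "p + t *\<^sub>R v \<in> D"
    then have "p + t *\<^sub>R v - t *\<^sub>R v \<in> span (insert v D)"
      by (intro span_diff) (auto intro: span_base span_mul)
    then show False using p by simp
  qed
  then show ?thesis using that p by (auto simp: line_through_def)
qed

text \<open>In the later parametrisation \<open>f\<close> of the hyperplane, the \<open>Some\<close>
  coordinates give the real parts and \<open>None\<close> the common imaginary part, before the
  rotation by \<open>w\<close>. Then \<open>V\<close> is the preimage of the diagonal.\<close>

lemma dim_constant_on_Some:
  defines "V \<equiv> {u :: real ^ ('n::finite) option. \<forall>j k. u $ Some j = u $ Some k}"
  shows "subspace V" and "dim V = 2"
proof -
  show "subspace V"
    unfolding V_def subspace_def by auto metis+
  define e :: "real ^ 'n option" where "e = axis None 1"
  define f :: "real ^ 'n option" where "f = (\<chi> i. if i = None then 0 else 1)"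
  have ne: "e \<noteq> f"
    by (auto simp: e_def f_def vec_eq_iff axis_def)
  have "independent {e, f}"
    using ne unfolding independent_explicit
    by (auto simp: e_def f_def vec_eq_iff axis_def split_option_all)
  moreover have "V = span {e, f}"
  proof
    show "V \<subseteq> span {e, f}"
    proof
      fix u assume "u \<in> V"
      \<comment> \<open>\<open>undefined\<close> is an arbitrary index: all \<open>Some\<close>
        coordinates of \<open>u\<close> agree.\<close>
      then have "u = (u $ None) *\<^sub>R e + (u $ Some undefined) *\<^sub>R f"
        by (auto simp: V_def e_def f_def vec_eq_iff axis_def split_option_all)
      then show "u \<in> span {e, f}"
        by (metis insert_iff span_add span_base span_mul)
    qed
    show "span {e, f} \<subseteq> V"
      using \<open>subspace V\<close> by (intro span_minimal) (auto simp: V_def e_def f_def axis_def)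
  qed
  ultimately show "dim V = 2" using ne by (simp add: dim_eq_card_independent)
qed

section \<open>Local charts of the set of segments\<close>

lemma manifold_n_segments: "manifold_of_dim (CARD('n::finite) + 2) (n_segments :: (complex ^ 'n) set)"
  unfolding manifold_of_dim_def
proof
  fix z :: "complex ^ 'n" assume "z \<in> n_segments"
  then obtain a b where ab: "z $ a \<noteq> z $ b" by (rule n_segments_neq)
  then have "a \<noteq> b" by auto
  define U where "U = n_segments \<inter> {u :: complex ^ 'n. u $ a \<noteq> u $ b}"
  \<comment> \<open>Coordinates \<open>a\<close> and \<open>b\<close> stay complex and the other n -
    2 hold the real ratios, which gives 4 + (n - 2) = n + 2 real dimensions.\<close>
  define V where "V = {u :: complex ^ 'n. \<forall>k. k \<noteq> a \<longrightarrow> k \<noteq> b \<longrightarrow> Im (u $ k) = 0}"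
  define W where "W = V \<inter> {u. u $ a \<noteq> u $ b}"
  have "open {u :: complex ^ 'n. u $ a \<noteq> u $ b}"
    by (intro open_Collect_neq continuous_intros)
  then have open_U: "openin (top_of_set n_segments) U" and open_W: "openin (top_of_set V) W"
    unfolding U_def W_def by (auto intro: openin_open_Int)
  define d :: "(complex ^ 'n) set" where "d = range (\<lambda>k. axis k 1) \<union> {axis a \<i>, axis b \<i>}"
  have "V = {u. \<forall>i\<in>Basis. i \<notin> d \<longrightarrow> u \<bullet> i = 0}"
    unfolding V_def d_def
    by (fastforce simp: Basis_vec_def Basis_complex_def inner_axis axis_eq_axis)
  moreover have "d \<subseteq> Basis"
    by (auto simp: d_def Basis_vec_def Basis_complex_def)
  moreover have "card d = CARD('n) + 2"
  proof -
    have "card (range (\<lambda>k::'n. axis k (1::complex))) = CARD('n)"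
      by (intro card_image injI) (simp add: axis_eq_axis)
    moreover have "card {axis a \<i>, axis b \<i>} = 2"
      using \<open>a \<noteq> b\<close> by (simp add: axis_eq_axis)
    moreover have "range (\<lambda>k::'n. axis k (1::complex)) \<inter> {axis a \<i>, axis b \<i>} = {}"
      by (auto simp: axis_eq_axis)
    ultimately show ?thesis unfolding d_def by (subst card_Un_disjoint) auto
  qed
  ultimately have dim_V: "dim V = CARD('n) + 2"
    using dim_substandard[of d] by simp
  have sub_V: "subspace V" by (auto simp: V_def subspace_def)
  define \<phi> :: "complex ^ 'n \<Rightarrow> complex ^ 'n" where
    "\<phi> u = (\<chi> k. if k = a \<or> k = b then u $ k else (u $ k - u $ a) / (u $ b - u $ a))" for u
  define \<psi> :: "complex ^ 'n \<Rightarrow> complex ^ 'n" where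
    "\<psi> u = (\<chi> k. if k = a \<or> k = b then u $ k else u $ a + u $ k * (u $ b - u $ a))" for u
  have "homeomorphism U W \<phi> \<psi>"
  proof (rule homeomorphismI)
    show "continuous_on U \<phi>"
      unfolding \<phi>_def
    proof (rule continuous_on_vec_lambda)
      fix k
      show "continuous_on U (\<lambda>u. if k = a \<or> k = b then u $ k
              else (u $ k - u $ a) / (u $ b - u $ a))"
        by (cases "k = a \<or> k = b") (auto simp: U_def intro!: continuous_intros)
    qed
    show "continuous_on W \<psi>"
      unfolding \<psi>_def
    proof (rule continuous_on_vec_lambda)
      fix k
      show "continuous_on W (\<lambda>u. if k = a \<or> k = b then u $ k
              else u $ a + u $ k * (u $ b - u $ a))"
        by (cases "k = a \<or> k = b") (auto intro!: continuous_intros)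
    qed
    show "\<phi> ` U \<subseteq> W"
    proof
      fix v assume "v \<in> \<phi> ` U"
      then obtain u where u: "u \<in> n_segments" "u $ a \<noteq> u $ b" and v: "v = \<phi> u"
        by (auto simp: U_def)
      obtain c w x where "norm w = 1" and x: "\<And>j. u $ j = c + w * of_real (x j)"
        using u(1) by (rule n_segmentsE) blast
      then have "w \<noteq> 0" by auto
      have "(u $ k - u $ a) / (u $ b - u $ a) = of_real ((x k - x a) / (x b - x a))" for k
        using \<open>w \<noteq> 0\<close> by (simp add: x flip: right_diff_distrib)
      then have "Im ((u $ k - u $ a) / (u $ b - u $ a)) = 0" for k
        by (metis Im_complex_of_real)
      then show "v \<in> W" using u(2) by (simp add: v W_def V_def \<phi>_def)
    qed
    show "\<psi> ` W \<subseteq> U"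
    proof
      fix v assume "v \<in> \<psi> ` W"
      then obtain u where u: "u \<in> V" "u $ a \<noteq> u $ b" and v: "v = \<psi> u"
        by (auto simp: W_def)
      \<comment> \<open>Position along the line from \<open>u $ a\<close> to \<open>u $ b\<close>,
        measured so that these two points sit at 0 and 1.\<close>
      define x where "x k = (if k = a then 0 else if k = b then 1 else Re (u $ k))" for k
      have "v $ k = u $ a + (u $ b - u $ a) * of_real (x k)" for k
        using u(1) by (auto simp: v \<psi>_def x_def V_def of_real_Re complex_is_Real_iff)
      then have "v \<in> n_segments"
        by (rule n_segmentsI[where k = a and l = b]) (use u \<open>a \<noteq> b\<close> in \<open>auto simp: x_def\<close>)
      then show "v \<in> U" using u(2) by (simp add: U_def v \<psi>_def)
    qed
    show "\<psi> (\<phi> u) = u" if "u \<in> U" for u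
      using that by (auto simp: U_def \<phi>_def \<psi>_def vec_eq_iff)
    show "\<phi> (\<psi> u) = u" if "u \<in> W" for u
      using that by (auto simp: W_def \<phi>_def \<psi>_def vec_eq_iff)
  qed
  then have "U homeomorphic W" by (auto simp: homeomorphic_def)
  moreover have "z \<in> U" using \<open>z \<in> n_segments\<close> ab by (simp add: U_def)
  ultimately show "\<exists>U V W. z \<in> U \<and> openin (top_of_set n_segments) U \<and> subspace (V :: (complex ^ 'n) set) \<and>
      dim V = CARD('n) + 2 \<and> openin (top_of_set V) W \<and> U homeomorphic W"
    using open_U open_W sub_V dim_V by blast
qed

section \<open>The hyperplane, the plane and the lines in the tangent space\<close>

theorem theorem3p7:
  assumes "CARD('n::finite) \<ge> 3"
  shows "manifold_of_dim (CARD('n) + 2) (n_segments :: (complex ^ 'n) set) \<and>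
    (\<forall>Z \<in> (n_segments :: (complex ^ 'n) set).
      (\<exists>\<L>. card \<L> = CARD('n) + 2 \<and> independent_lines \<L> \<and>
         (\<forall>L\<in>\<L>. L \<subseteq> n_segments \<inter> affine_tangent_space n_segments Z)) \<and>
      (\<exists>S V. S \<subseteq> n_segments \<inter> affine_tangent_space n_segments Z \<and>
         subspace V \<and> dim V = 2 \<and> isometric S (UNIV - V :: (real ^ 'n option) set)) \<and>
      (\<exists>S. S \<subseteq> n_segments \<inter> affine_tangent_space n_segments Z \<and>
         isometric S (UNIV - {0} :: (real ^ 2) set)))"
proof (intro conjI ballI)
  show "manifold_of_dim (CARD('n) + 2) (n_segments :: (complex ^ 'n) set)"
    by (rule manifold_n_segments)
next
  fix Z :: "complex ^ 'n" assume "Z \<in> n_segments"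
  then obtain b w x k l where w: "norm w = 1" and Z: "\<And>j. Z $ j = b + w * of_real (x j)"
    and kl: "x k \<noteq> (x l :: real)"
    by (rule n_segmentsE) blast
  have w0: "w \<noteq> 0" using w by auto
  let ?X = "n_segments \<inter> affine_tangent_space n_segments Z"
  note tangent = mem_affine_tangent_space_n_segments[OF Z w0 kl]

  \<comment> \<open>The factor \<open>1 / sqrt n\<close> makes \<open>f\<close> norm preserving; its range is the hyperplane \<open>H\<close>.\<close>
  define c where "c = 1 / sqrt (real CARD('n))"
  have c: "real CARD('n) * c\<^sup>2 = 1" by (simp add: c_def power_divide)
  define f :: "real ^ 'n option \<Rightarrow> complex ^ 'n" where
    "f u = (\<chi> j. w * (of_real (u $ Some j) + \<i> * of_real (c * u $ None)))" for u
  define V where "V = {u :: real ^ 'n option. \<forall>j k. u $ Some j = u $ Some k}"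
  have V: "subspace V" "dim V = 2" unfolding V_def by (rule dim_constant_on_Some)+
  have lin: "linear f"
    by (rule linearI) (auto simp: f_def vec_eq_iff algebra_simps scaleR_conv_of_real[where 'a=complex])
  have norm_f: "norm (f u) = norm u" for u
  proof -
    have "(norm (f u))\<^sup>2 = (\<Sum>j\<in>UNIV. (u $ Some j)\<^sup>2 + c\<^sup>2 * (u $ None)\<^sup>2)"
      unfolding norm_vec_def L2_set_def
      by (simp add: f_def norm_mult w sum_nonneg cmod_power2 power_mult_distrib)
    also have "\<dots> = (\<Sum>j\<in>UNIV. (u $ Some j)\<^sup>2) + real CARD('n) * c\<^sup>2 * (u $ None)\<^sup>2"
      by (simp add: sum.distrib)
    also have "\<dots> = (norm u)\<^sup>2"
      unfolding norm_vec_def L2_set_def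
      by (simp add: c sum_nonneg UNIV_option_conv sum.reindex)
    finally show ?thesis by (simp add: power2_eq_iff_nonneg)
  qed
  note f_iso = norm_preserving_linear_isometric[OF lin norm_f]
  have f_X: "f u \<in> ?X" if u: "u \<notin> V" for u
  proof
    obtain i j where ij: "u $ Some i \<noteq> u $ Some j" using u by (auto simp: V_def)
    show "f u \<in> n_segments"
      by (rule n_segmentsI[where w = w and x = "\<lambda>j. u $ Some j" and b = "w * \<i> * of_real (c * u $ None)", OF _ w0 ij])
        (simp add: f_def algebra_simps)
    show "f u \<in> affine_tangent_space n_segments Z"
      by (rule tangent[where y = "\<lambda>j. u $ Some j" and s = "c * u $ None" and r = 0])
        (simp add: f_def)
  qed
  then show "\<exists>S V. S \<subseteq> ?X \<and> subspace V \<and> dim V = 2 \<and> isometric S (UNIV - V :: (real ^ 'n option) set)"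
    using V f_iso(2)[of "UNIV - V"]
    by (intro exI[of _ "f ` (UNIV - V)"] exI[of _ V]) auto

  define X :: "real ^ 'n" where "X = (\<chi> j. x j)"
  have X0: "X \<noteq> 0" using kl unfolding X_def vec_eq_iff by (metis vec_lambda_beta zero_index)
  define g :: "complex \<Rightarrow> complex ^ 'n" where "g \<gamma> = (\<chi> j. w * \<gamma> * of_real (x j))" for \<gamma>
  have g_X: "g \<gamma> \<in> ?X" if "\<gamma> \<noteq> 0" for \<gamma>
  proof
    show "g \<gamma> \<in> n_segments"
      by (rule n_segmentsI[where w = "w * \<gamma>" and x = x and b = 0, OF _ _ kl])
        (use that w0 in \<open>auto simp: g_def\<close>)
    show "g \<gamma> \<in> affine_tangent_space n_segments Z"
    proof (rule tangent[where y = "\<lambda>j. Re \<gamma> * x j" and s = 0 and r = "Im \<gamma>"])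
      fix j show "g \<gamma> $ j = w * (of_real (Re \<gamma> * x j) + \<i> * of_real (0 + Im \<gamma> * x j))"
        by (simp add: g_def complex_eq_iff algebra_simps)
    qed
  qed
  \<comment> \<open>\<open>g\<close> scales norms by \<open>norm X\<close>, which the division
    compensates.\<close>
  define h :: "real ^ 2 \<Rightarrow> complex ^ 'n" where
    "h a = g (Complex (a $ 1) (a $ 2) /\<^sub>R norm X)" for a
  have "linear h"
    by (rule linearI) (auto simp: h_def g_def vec_eq_iff complex_eq_iff algebra_simps)
  moreover have "norm (h a) = norm a" for a
  proof -
    have "norm (g \<gamma>) = norm \<gamma> * norm X" for \<gamma>
      unfolding norm_vec_def
      by (simp add: g_def X_def norm_mult w L2_set_right_distrib)
    then have "norm (h a) = norm (Complex (a $ 1) (a $ 2))"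
      using X0 by (simp add: h_def del: complex_norm)
    then show ?thesis
      by (simp add: norm_vec_def[of a] L2_set_def UNIV_2 complex_norm)
  qed
  ultimately have "isometric (h ` (UNIV - {0})) (UNIV - {0} :: (real ^ 2) set)"
    by (intro norm_preserving_linear_isometric(2))
  moreover have "h ` (UNIV - {0}) \<subseteq> ?X"
  proof -
    have "h a \<in> ?X" if "a \<noteq> 0" for a
      unfolding h_def
      by (rule g_X) (use that X0 in \<open>auto simp: vec_eq_iff forall_2 complex_eq_iff\<close>)
    then show ?thesis by auto
  qed
  ultimately show "\<exists>S. S \<subseteq> ?X \<and> isometric S (UNIV - {0} :: (real ^ 2) set)"
    by blast

  obtain B where B: "B \<subseteq> range f" "independent B" "range f \<subseteq> span B" "card B = dim (range f)"
    using basis_exists by blast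
  have dim_f: "dim (range f) = CARD('n) + 1"
    using dim_image_eq[OF lin, of UNIV] f_iso(1) by (simp add: dim_UNIV)
  have "subspace (range f)" using lin by (simp add: linear_subspace_image)
  then have "span B = range f"
    using B by (metis span_minimal subset_antisym)
  \<comment> \<open>After division by \<open>w\<close>, points of \<open>range f\<close> have the
    same imaginary part in every coordinate, whereas \<open>g \<i>\<close> has the non-constant
    \<open>x j\<close>.\<close>
  moreover have "g \<i> \<notin> range f"
  proof
    assume "g \<i> \<in> range f"
    then obtain u where "g \<i> = f u" by blast
    then have "\<i> * of_real (x j) = of_real (u $ Some j) + \<i> * of_real (c * u $ None)" for j
      using w0 by (auto simp: g_def f_def vec_eq_iff)
    then have "x j = c * u $ None" for j
      by (auto simp: complex_eq_iff)
    then show False using kl by simp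
  qed
  ultimately have ind: "independent (insert (g \<i>) B)" and "g \<i> \<notin> B"
    using B by (auto simp: independent_insert)
  then have card: "card (insert (g \<i>) B) = CARD('n) + 2"
    using B dim_f by (simp add: independent_imp_finite)
  have "\<exists>p. line_through p v \<subseteq> ?X" if v_in: "v \<in> insert (g \<i>) B" for v
  proof (cases "v = g \<i>")
    case True
    \<comment> \<open>The base point \<open>g 1\<close> keeps the line in this plane away from the
      origin.\<close>
    have "g 1 + t *\<^sub>R g \<i> = g (Complex 1 t)" for t
      by (auto simp: g_def vec_eq_iff complex_eq_iff algebra_simps)
    moreover have "Complex 1 t \<noteq> 0" for t by (simp add: complex_eq_iff)
    ultimately have "line_through (g 1) v \<subseteq> ?X"
      unfolding True line_through_def using g_X by auto
    then show ?thesis ..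
  next
    case False
    then obtain u where v: "v = f u" using v_in B by auto
    \<comment> \<open>This is 2 + 1 < n + 1, where n >= 3 enters.\<close>
    have "dim V + 1 < dim (UNIV :: (real ^ 'n option) set)"
      using V assms by (simp add: dim_UNIV)
    then obtain p where "line_through p u \<inter> V = {}"
      by (rule exists_line_avoiding_subspace)
    moreover have "line_through (f p) v = f ` line_through p u"
      unfolding line_through_def v image_image
      by (simp add: linear_add[OF lin] linear_scale[OF lin])
    ultimately have "line_through (f p) v \<subseteq> ?X" using f_X by auto
    then show ?thesis ..
  qed
  then show "\<exists>\<L>. card \<L> = CARD('n) + 2 \<and> independent_lines \<L> \<and> (\<forall>L\<in>\<L>. L \<subseteq> ?X)"
    using independent_lines_of_directions[OF ind, of ?X] card by metis
qed

end
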